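(* Let $1<p<\infty$, let $T=(V,E)$ be a leafless, locally finite rooted directed tree with root $o$, and let $\lambda=(\lambda_u)_{u\in V\setminus\{o\}}$ be a family of complex weights such that $B_\lambda$ is bounded on $\operatorname{Ces}_p(T)$. Let $\mathcal F$ be a Furstenberg family on $\mathbb N_0$. Then the following assertions are equivalent: (i) $B_\lambda$ is $\widetilde{\mathcal F}$-transitive on $\operatorname{Ces}_p(T)$; (ii) $B_\lambda$ is $\mathcal F$-transitive on $\operatorname{Ces}_p(T)$; (iii) for every nonempty finite set $F\subseteq V$ and every $N\in\mathbb N$, $$\bigcap_{v\in F}\Bigl\{n\in\mathbb N_0:\ c_{|v|+n}\,\Phi_p(|v|+n)\max_{u\in\operatorname{Chi}^n(v)}|\lambda(v\to u)|>N\Bigr\}\in\mathcal F.$$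
   Context: Trees. A directed tree $T=(V,E)$ has a countably infinite vertex set $V$ and edge set $E\subseteq V\times V$ such that the underlying undirected graph is connected and has no cycles, and every vertex has at most one parent (a parent of $v$ is a vertex $w$ with $(w,v)\in E$). It is rooted if it has a unique vertex $o$ (the root) without a parent. The set of children of $v$ is $\operatorname{Chi}(v)=\{u\in V:(v,u)\in E\}$; $\operatorname{Chi}^0(v)=\{v\}$ and $\operatorname{Chi}^{n+1}(v)=\bigcup_{u\in\operatorname{Chi}^n(v)}\operatorname{Chi}(u)$. The tree is locally finite if every $\operatorname{Chi}(v)$ is finite, and leafless if every $\operatorname{Chi}(v)$ is nonempty. For $v\in V$, $|v|$ is the length of the unique path from $o$ to $v$; $D_n=\{v\in V:|v|=n\}$ and $c_n=|D_n|$ (cardinality) for $n\in\mathbb N_0$. Ces\`aro space. For $f:V\to\mathbb C$ put $A_n(f)=\frac1{c_n}\sum_{v\in D_n}|f(v)|$. For $1<p<\infty$, $\operatorname{Ces}_p(T)$ is the space of all $f:V\to\mathbb C$ with $$\|f\|_{\operatorname{Ces}_p(T)}=\Biggl[\sum_{n=0}^\infty\biggl(\frac1{n+1}\sum_{r=0}^nA_r(f)\biggr)^p\Biggr]^{1/p}<\infty;$$ it is a separable Banach space with this norm. For $N\in\mathbb N_0$, $\Phi_p(N)=\bigl(\sum_{s=N}^\infty\frac1{(s+1)^p}\bigr)^{-1/p}$. Weighted backward shift. $B_\lambda f(v)=\sum_{u\in\operatorname{Chi}(v)}\lambda_uf(u)$, $v\in V$; "bounded on $\operatorname{Ces}_p(T)$"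 means that $B_\lambda$ maps $\operatorname{Ces}_p(T)$ into itself as a bounded linear operator. If $u\in\operatorname{Chi}^n(v)$ and $v=v_0,v_1,\dots,v_n=u$ is the unique path from $v$ to $u$, then $\lambda(v\to u)=\prod_{j=1}^n\lambda_{v_j}$ (so $\lambda(v\to v)=1$). Furstenberg families and transitivity. A nonempty family $\mathcal F$ of subsets of $\mathbb N_0$ is a Furstenberg family if every $A\in\mathcal F$ is infinite and $A\in\mathcal F$, $A\subseteq B\subseteq\mathbb N_0$ imply $B\in\mathcal F$. The family $\widetilde{\mathcal F}$ consists of all $A\subseteq\mathbb N_0$ such that for every $N\in\mathbb N_0$ there is $B\in\mathcal F$ with $(B+[-N,N])\cap\mathbb N_0\subseteq A$, where $[-N,N]$ denotes the integer interval. For a family $\mathcal G$ of subsets of $\mathbb N_0$, a bounded operator $S$ on a separable Banach space $X$ is $\mathcal G$-transitive if $\{n\in\mathbb N_0:S^n(U)\cap W\ne\varnothing\}\in\mathcal G$ for all nonempty open sets $U,W\subseteq X$. *)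

theory Defs
  imports "HOL-Analysis.Analysis"
begin

text \<open>
  A directed graph is given by its vertex set \<open>V\<close> and its edge set \<open>E\<close>. An undirected path is
  represented by the nonempty list of its pairwise distinct vertices; an undirected cycle by a list
  of at least three pairwise distinct vertices whose last vertex is adjacent to the first one.
\<close>

definition adjacent :: "('a \<times> 'a) set \<Rightarrow> 'a \<Rightarrow> 'a \<Rightarrow> bool" where
  "adjacent E u v \<longleftrightarrow> (u, v) \<in> E \<or> (v, u) \<in> E"

definition is_path :: "('a \<times> 'a) set \<Rightarrow> 'a \<Rightarrow> 'a \<Rightarrow> 'a list \<Rightarrow> bool" where
  "is_path E u v xs \<longleftrightarrow>
     xs \<noteq> [] \<and> hd xs = u \<and> last xs = v \<and> distinct xs \<and> successively (adjacent E) xs"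

definition is_cycle :: "('a \<times> 'a) set \<Rightarrow> 'a list \<Rightarrow> bool" where
  "is_cycle E xs \<longleftrightarrow>
     length xs \<ge> 3 \<and> distinct xs \<and> successively (adjacent E) xs \<and> adjacent E (last xs) (hd xs)"

text \<open>
  Loops and pairs of opposite edges are not seen by \<^const>\<open>is_cycle\<close>, so they are excluded
  separately.
\<close>

definition directed_tree :: "'a set \<Rightarrow> ('a \<times> 'a) set \<Rightarrow> bool" where
  "directed_tree V E \<longleftrightarrow>
     countable V \<and> infinite V \<and> E \<subseteq> V \<times> V \<and>
     (\<forall>u v. (u, v) \<in> E \<longrightarrow> (v, u) \<notin> E) \<and>
     (\<forall>u\<in>V. \<forall>v\<in>V. \<exists>xs. is_path E u v xs) \<and>
     (\<nexists>xs. is_cycle E xs) \<and>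
     (\<forall>v w w'. (w, v) \<in> E \<longrightarrow> (w', v) \<in> E \<longrightarrow> w = w')"

definition rooted_directed_tree :: "'a set \<Rightarrow> ('a \<times> 'a) set \<Rightarrow> 'a \<Rightarrow> bool" where
  "rooted_directed_tree V E r \<longleftrightarrow>
     directed_tree V E \<and> r \<in> V \<and> (\<forall>v\<in>V. (\<nexists>w. (w, v) \<in> E) \<longleftrightarrow> v = r)"

definition Chi :: "('a \<times> 'a) set \<Rightarrow> 'a \<Rightarrow> 'a set" where
  "Chi E v = {u. (v, u) \<in> E}"

fun Chi_iter :: "('a \<times> 'a) set \<Rightarrow> nat \<Rightarrow> 'a \<Rightarrow> 'a set" where
  "Chi_iter E 0 v = {v}"
| "Chi_iter E (Suc n) v = (\<Union>u\<in>Chi_iter E n v. Chi E u)"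

definition locally_finite_tree :: "'a set \<Rightarrow> ('a \<times> 'a) set \<Rightarrow> bool" where
  "locally_finite_tree V E \<longleftrightarrow> (\<forall>v\<in>V. finite (Chi E v))"

definition leafless :: "'a set \<Rightarrow> ('a \<times> 'a) set \<Rightarrow> bool" where
  "leafless V E \<longleftrightarrow> (\<forall>v\<in>V. Chi E v \<noteq> {})"

definition the_path :: "('a \<times> 'a) set \<Rightarrow> 'a \<Rightarrow> 'a \<Rightarrow> 'a list" where
  "the_path E u v = (THE xs. is_path E u v xs)"

text \<open>The length of a path is its number of edges.\<close>

definition depth :: "('a \<times> 'a) set \<Rightarrow> 'a \<Rightarrow> 'a \<Rightarrow> nat" where
  "depth E r v = length (the_path E r v) - 1"

definition generation :: "'a set \<Rightarrow> ('a \<times> 'a) set \<Rightarrow> 'a \<Rightarrow> nat \<Rightarrow> 'a set" where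
  "generation V E r n = {v \<in> V. depth E r v = n}"

definition gen_card :: "'a set \<Rightarrow> ('a \<times> 'a) set \<Rightarrow> 'a \<Rightarrow> nat \<Rightarrow> nat" where
  "gen_card V E r n = card (generation V E r n)"

definition gen_mean :: "'a set \<Rightarrow> ('a \<times> 'a) set \<Rightarrow> 'a \<Rightarrow> nat \<Rightarrow> ('a \<Rightarrow> complex) \<Rightarrow> real" where
  "gen_mean V E r n f = 1 / real (gen_card V E r n) * (\<Sum>v\<in>generation V E r n. cmod (f v))"

definition ces_term :: "'a set \<Rightarrow> ('a \<times> 'a) set \<Rightarrow> 'a \<Rightarrow> real \<Rightarrow> ('a \<Rightarrow> complex) \<Rightarrow> nat \<Rightarrow> real" where
  "ces_term V E r p f n = (1 / (real n + 1) * (\<Sum>k=0..n. gen_mean V E r k f)) powr p"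

text \<open>
  Functions from \<open>V\<close> to the complex numbers are represented by functions on the ambient type that
  vanish outside \<open>V\<close>.
\<close>

definition Ces :: "'a set \<Rightarrow> ('a \<times> 'a) set \<Rightarrow> 'a \<Rightarrow> real \<Rightarrow> ('a \<Rightarrow> complex) set" where
  "Ces V E r p = {f. (\<forall>v. v \<notin> V \<longrightarrow> f v = 0) \<and> summable (ces_term V E r p f)}"

definition ces_norm :: "'a set \<Rightarrow> ('a \<times> 'a) set \<Rightarrow> 'a \<Rightarrow> real \<Rightarrow> ('a \<Rightarrow> complex) \<Rightarrow> real" where
  "ces_norm V E r p f = (\<Sum>n. ces_term V E r p f n) powr (1 / p)"

definition ces_topology ::
  "'a set \<Rightarrow> ('a \<times> 'a) set \<Rightarrow> 'a \<Rightarrow> real \<Rightarrow> ('a \<Rightarrow> complex) topology" where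
  "ces_topology V E r p =
     Metric_space.mtopology (Ces V E r p) (\<lambda>f g. ces_norm V E r p (\<lambda>v. f v - g v))"

definition ces_bounded_operator ::
  "'a set \<Rightarrow> ('a \<times> 'a) set \<Rightarrow> 'a \<Rightarrow> real \<Rightarrow> (('a \<Rightarrow> complex) \<Rightarrow> ('a \<Rightarrow> complex)) \<Rightarrow> bool" where
  "ces_bounded_operator V E r p S \<longleftrightarrow>
     (\<forall>f\<in>Ces V E r p. S f \<in> Ces V E r p) \<and>
     (\<forall>f\<in>Ces V E r p. \<forall>g\<in>Ces V E r p. S (\<lambda>v. f v + g v) = (\<lambda>v. S f v + S g v)) \<and>
     (\<forall>f\<in>Ces V E r p. \<forall>c. S (\<lambda>v. c * f v) = (\<lambda>v. c * S f v)) \<and>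
     (\<exists>C. \<forall>f\<in>Ces V E r p. ces_norm V E r p (S f) \<le> C * ces_norm V E r p f)"

definition Phi :: "real \<Rightarrow> nat \<Rightarrow> real" where
  "Phi p N = (\<Sum>s. 1 / (real (N + s) + 1) powr p) powr (- 1 / p)"

text \<open>
  A weight family is a function on the whole ambient type; its value at the root is never used,
  because the root is nobody's child.
\<close>

definition backward_shift ::
  "('a \<times> 'a) set \<Rightarrow> ('a \<Rightarrow> complex) \<Rightarrow> ('a \<Rightarrow> complex) \<Rightarrow> ('a \<Rightarrow> complex)" where
  "backward_shift E w f = (\<lambda>v. \<Sum>u\<in>Chi E v. w u * f u)"

definition path_weight :: "('a \<times> 'a) set \<Rightarrow> ('a \<Rightarrow> complex) \<Rightarrow> 'a \<Rightarrow> 'a \<Rightarrow> complex" where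
  "path_weight E w v u = prod_list (map w (tl (the_path E v u)))"

definition furstenberg_family :: "nat set set \<Rightarrow> bool" where
  "furstenberg_family \<F> \<longleftrightarrow>
     \<F> \<noteq> {} \<and> (\<forall>A\<in>\<F>. infinite A) \<and> (\<forall>A\<in>\<F>. \<forall>B. A \<subseteq> B \<longrightarrow> B \<in> \<F>)"

definition thickening :: "nat set \<Rightarrow> nat \<Rightarrow> nat set" where
  "thickening B N = {n. \<exists>b\<in>B. \<exists>k\<in>{- int N..int N}. int n = int b + k}"

definition tilde_family :: "nat set set \<Rightarrow> nat set set" where
  "tilde_family \<F> = {A. \<forall>N. \<exists>B\<in>\<F>. thickening B N \<subseteq> A}"

definition family_transitive :: "nat set set \<Rightarrow> 'b topology \<Rightarrow> ('b \<Rightarrow> 'b) \<Rightarrow> bool" where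
  "family_transitive \<G> X S \<longleftrightarrow>
     (\<forall>U W. openin X U \<and> U \<noteq> {} \<and> openin X W \<and> W \<noteq> {} \<longrightarrow>
        {n. (S ^^ n) ` U \<inter> W \<noteq> {}} \<in> \<G>)"

end

theory Submission imports Defs begin

text \<open>
  Write \<open>B\<close> for the shift and \<open>\<lambda>(v \<rightarrow> u)\<close> for path weights. Two computations drive the proof. A unit
  point mass in generation \<open>m\<close> has norm \<open>1 / (c\<^sub>m * \<Phi>\<^sub>p(m))\<close> (lemma \<open>point_mass_CES\<close>), and this is
  extremal: the sum of \<open>\<bar>f\<bar>\<close> over generation \<open>m\<close> is at most \<open>c\<^sub>m * \<Phi>\<^sub>p(m)\<close> times the norm of \<open>f\<close>
  (lemma \<open>generation_sum_le\<close>). Moreover \<open>(B ^^ n) f\<close> takes at \<open>v\<close> the value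
  \<open>\<Sum>\<^sub>u \<lambda>(v \<rightarrow> u) * f u\<close>, where \<open>u\<close> runs through the descendants of \<open>v\<close> \<open>n\<close> generations below it
  (lemma \<open>backward_shift_funpow\<close>). So the quantity in assertion (iii), here called the gain at \<open>v\<close> and
  time \<open>n\<close>, is the norm of the functional \<open>f \<mapsto> (B ^^ n) f v\<close>, and it is attained by a point mass.

  (i) implies (ii) because every member of \<open>tilde_family \<F>\<close> contains a member of \<open>\<F>\<close>.

  (ii) implies (iii): if \<open>B ^^ n\<close> maps some \<open>f\<close> of norm below \<open>1 / (2 * N)\<close> close to the indicator
  function of \<open>F\<close>, then \<open>(B ^^ n) f\<close> has modulus above \<open>1 / 2\<close> at each \<open>v \<in> F\<close>, so that the gains at
  these vertices exceed \<open>N\<close> (lemma \<open>transitive_imp_large_gain\<close>).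

  (iii) implies (i): by density, let the two open sets be neighbourhoods of finitely supported \<open>f\<close>
  and \<open>g\<close>. As the tree is rooted, \<open>(B ^^ m) f = 0\<close> for large \<open>m\<close>. If the gains at time \<open>m\<close> are
  large on the support of \<open>g\<close>, then \<open>g\<close> has a preimage \<open>h\<close> of small norm under \<open>B ^^ m\<close> (lemma
  \<open>small_preimage\<close>), and \<open>f + h\<close> is mapped to \<open>g\<close>. It remains to make the gains large on a whole
  window \<open>n - K \<le> m \<le> n + K\<close> for all \<open>n\<close> in a member of \<open>\<F>\<close> (lemma \<open>large_gain_window\<close>).
  For the right end of the window, (iii) is applied not to \<open>v\<close> but to a descendant \<open>K\<close> generations
  below \<open>v\<close> with nonzero path weight. Boundedness of \<open>B\<close> implies that the gain at time \<open>m + 1\<close> is at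
  most a constant times the gain at time \<open>m\<close> (lemma \<open>gain_Suc_le\<close>), which carries the estimate back
  to the left end.
\<close>

section \<open>Paths and generations in a rooted directed tree\<close>

lemma is_path_refl: "is_path E u u [u]"
  by (simp add: is_path_def)

lemma is_path_refl_unique:
  assumes "is_path E u u xs"
  shows "xs = [u]"
  using assms unfolding is_path_def by (cases xs) (auto split: if_splits)

lemma adjacent_sym: "adjacent E u v \<longleftrightarrow> adjacent E v u"
  by (auto simp: adjacent_def)

text \<open>
  Two paths that leave \<open>u\<close> through different vertices meet again for a first time, at the latest in
  their common end; the two initial pieces up to that meeting point, glued at \<open>u\<close>, form a cycle.
\<close>

lemma is_path_unique:
  assumes acyclic: "\<nexists>xs. is_cycle E xs"
  shows "is_path E u v xs \<Longrightarrow> is_path E u v ys \<Longrightarrow> xs = ys"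
proof (induction xs arbitrary: u ys)
  case Nil
  then show ?case by (simp add: is_path_def)
next
  case (Cons x xs)
  have x: "x = u" using Cons.prems(1) by (simp add: is_path_def)
  show ?case
  proof (cases "u = v")
    case True
    then show ?thesis using Cons.prems is_path_refl_unique by metis
  next
    case False
    then have xs: "xs \<noteq> []" "last xs = v" "distinct (u # xs)" "successively (adjacent E) xs"
        "adjacent E u (hd xs)"
      using Cons.prems(1) x by (auto simp: is_path_def successively_Cons split: if_splits)
    obtain zs where ys: "ys = u # zs"
      using Cons.prems(2) by (cases ys) (auto simp: is_path_def)
    have zs: "zs \<noteq> []" "last zs = v" "distinct (u # zs)" "successively (adjacent E) zs"
        "adjacent E u (hd zs)"
      using Cons.prems(2) ys False by (auto simp: is_path_def successively_Cons split: if_splits)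
    have "hd xs = hd zs"
    proof (rule ccontr)
      assume ne: "hd xs \<noteq> hd zs"
      have "\<exists>z\<in>set zs. z \<in> set xs"
        using xs(1,2) zs(1,2) last_in_set by metis
      then obtain q1 z q2 where q: "zs = q1 @ z # q2" "z \<in> set xs" "\<forall>y\<in>set q1. y \<notin> set xs"
        using split_list_first_prop[of zs "\<lambda>z. z \<in> set xs"] by blast
      then obtain p1 p2 where p: "xs = p1 @ z # p2"
        by (meson split_list)
      let ?c = "u # p1 @ [z] @ rev q1"
      have sx: "successively (adjacent E) (p1 @ [z])"
        using xs(4) p by (auto simp: successively_append_iff successively_Cons)
      have sz: "successively (adjacent E) (z # rev q1)"
      proof -
        have "successively (adjacent E) (q1 @ [z])"
          using zs(4) q(1) by (auto simp: successively_append_iff successively_Cons)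
        then have "successively (adjacent E) (rev (q1 @ [z]))"
          unfolding successively_rev by (rule successively_mono) (simp add: adjacent_sym)
        then show ?thesis by simp
      qed
      have "distinct ?c"
        using xs(3) zs(3) p q by auto
      moreover have "length ?c \<ge> 3"
        using ne p q by (cases p1; cases q1) auto
      moreover have "successively (adjacent E) ?c"
      proof -
        have "successively (adjacent E) (p1 @ z # rev q1)"
          using sx sz by (auto simp: successively_append_iff)
        moreover have "adjacent E u (hd (p1 @ z # rev q1))"
          using xs(5) p by (cases p1) auto
        ultimately show ?thesis by (simp add: successively_Cons)
      qed
      moreover have "adjacent E (last ?c) (hd ?c)"
      proof -
        have "last ?c = hd zs"
          using q(1) by (cases q1) auto
        then show ?thesis using zs(5) by (simp add: adjacent_sym)
      qed
      ultimately have "is_cycle E ?c"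
        unfolding is_cycle_def by blast
      then show False using acyclic by blast
    qed
    then have "is_path E (hd xs) v xs" "is_path E (hd xs) v zs"
      using xs zs by (auto simp: is_path_def)
    then show ?thesis using Cons.IH x ys by blast
  qed
qed

lemma Chi_iter_add: "Chi_iter E (m + n) v = (\<Union>x\<in>Chi_iter E m v. Chi_iter E n x)"
  by (induction n) auto

locale rooted_tree =
  fixes V :: "'a set" and E :: "('a \<times> 'a) set" and r :: 'a
  assumes rooted: "rooted_directed_tree V E r"
begin

lemma r_in_V: "r \<in> V"
  using rooted by (simp add: rooted_directed_tree_def)

lemma directed_tree: "directed_tree V E"
  using rooted by (simp add: rooted_directed_tree_def)

lemma E_subset: "(u, v) \<in> E \<Longrightarrow> u \<in> V \<and> v \<in> V"
  using directed_tree by (auto simp: directed_tree_def)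

lemma E_antisym: "(u, v) \<in> E \<Longrightarrow> (v, u) \<notin> E"
  using directed_tree by (simp add: directed_tree_def)

lemma connected: "u \<in> V \<Longrightarrow> v \<in> V \<Longrightarrow> \<exists>xs. is_path E u v xs"
  using directed_tree by (simp add: directed_tree_def)

lemma acyclic: "\<nexists>xs. is_cycle E xs"
  using directed_tree by (simp add: directed_tree_def)

lemma parent_unique: "(x, v) \<in> E \<Longrightarrow> (y, v) \<in> E \<Longrightarrow> x = y"
  using directed_tree unfolding directed_tree_def by metis

lemma root_no_parent: "(x, r) \<notin> E"
proof -
  have "\<forall>v\<in>V. (\<nexists>x. (x, v) \<in> E) \<longleftrightarrow> v = r"
    using rooted by (simp add: rooted_directed_tree_def)
  then show ?thesis using r_in_V by blast
qed

lemma the_path_eq: "is_path E u v xs \<Longrightarrow> the_path E u v = xs"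
  unfolding the_path_def by (blast intro: the_equality is_path_unique[OF acyclic])

lemma Chi_in_V: "u \<in> Chi E v \<Longrightarrow> u \<in> V"
  using E_subset by (auto simp: Chi_def)

lemma Chi_iter_in_V: "u \<in> Chi_iter E n v \<Longrightarrow> v \<in> V \<Longrightarrow> u \<in> V"
  by (induction n arbitrary: u) (auto dest: Chi_in_V)

lemma Chi_disjoint: "u \<in> Chi E v \<Longrightarrow> u \<in> Chi E v' \<Longrightarrow> v = v'"
  by (auto simp: Chi_def intro: parent_unique)

lemma Chi_iter_disjoint: "u \<in> Chi_iter E n v \<Longrightarrow> u \<in> Chi_iter E n v' \<Longrightarrow> v = v'"
  by (induction n arbitrary: u) (auto dest: Chi_disjoint)

text \<open>
  Every edge of a path that starts in the root points away from the root: the root has no parent,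
  and the parent of any later vertex is the vertex before it, so that an edge pointing backwards
  would lead to a vertex the path has already visited.
\<close>

lemma path_from_root_descends:
  "is_path E r v xs \<Longrightarrow>
     v \<in> Chi_iter E (length xs - 1) r \<and> (\<forall>z. (z, v) \<in> E \<longrightarrow> z \<in> set xs)"
proof (induction xs arbitrary: v rule: rev_induct)
  case Nil
  then show ?case by (simp add: is_path_def)
next
  case (snoc x xs)
  have x: "x = v" using snoc.prems by (simp add: is_path_def)
  show ?case
  proof (cases "xs = []")
    case True
    then have "v = r" using snoc.prems x by (simp add: is_path_def)
    then show ?thesis using True root_no_parent by auto
  next
    case False
    define y where "y = last xs"
    have path: "is_path E r y xs" and adj: "adjacent E y v" and new: "v \<notin> set xs"
      using snoc.prems False x by (auto simp: is_path_def successively_append_iff y_def)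
    have "(y, v) \<in> E"
      using adj new snoc.IH[OF path] by (auto simp: adjacent_def)
    moreover have "y \<in> set xs" using False by (simp add: y_def)
    moreover obtain k where k: "length xs = Suc k" using False by (cases xs) auto
    moreover have "y \<in> Chi_iter E k r" using snoc.IH[OF path] k by simp
    ultimately have "v \<in> Chi_iter E (Suc k) r" "\<forall>z. (z, v) \<in> E \<longrightarrow> z \<in> set xs"
      using parent_unique by (auto simp: Chi_def)
    then show ?thesis using k by simp
  qed
qed

lemma Chi_iter_root_path:
  "v \<in> Chi_iter E n r \<Longrightarrow> \<exists>xs. is_path E r v xs \<and> length xs = Suc n"
proof (induction n arbitrary: v)
  case 0
  then show ?case using is_path_refl[of E r] by (intro exI[of _ "[r]"]) simp
next
  case (Suc n)
  then obtain x where x: "x \<in> Chi_iter E n r" "(x, v) \<in> E"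
    by (auto simp: Chi_def)
  then obtain xs where xs: "is_path E r x xs" "length xs = Suc n"
    using Suc.IH by blast
  have "v \<notin> set xs"
  proof
    assume "v \<in> set xs"
    then obtain ys zs where yz: "xs = ys @ v # zs" by (meson split_list)
    then have "is_path E r v (ys @ [v])"
      using xs(1) by (auto simp: is_path_def successively_append_iff successively_Cons hd_append)
    then have "x \<in> set (ys @ [v])" using path_from_root_descends x(2) by blast
    moreover have "x \<noteq> v" using x(2) E_antisym by blast
    moreover have "last xs = x" "distinct xs" using xs(1) by (auto simp: is_path_def)
    ultimately show False using yz by (auto split: if_splits)
  qed
  then have "is_path E r v (xs @ [v])"
    using xs(1) x(2) by (auto simp: is_path_def successively_append_iff adjacent_def)
  then show ?case using xs(2) by (intro exI[of _ "xs @ [v]"]) simp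
qed

lemma depth_Chi_iter_root: "v \<in> Chi_iter E n r \<Longrightarrow> depth E r v = n"
proof -
  assume "v \<in> Chi_iter E n r"
  then obtain xs where "is_path E r v xs" "length xs = Suc n" using Chi_iter_root_path by blast
  then show ?thesis by (simp add: depth_def the_path_eq)
qed

lemma generation_eq_Chi_iter: "generation V E r n = Chi_iter E n r"
proof (intro equalityI subsetI)
  fix v assume "v \<in> generation V E r n"
  then have v: "v \<in> V" "depth E r v = n" by (auto simp: generation_def)
  then obtain xs where xs: "is_path E r v xs" using connected r_in_V by blast
  then have "n = length xs - 1" using v(2) the_path_eq by (auto simp: depth_def)
  then show "v \<in> Chi_iter E n r" using path_from_root_descends[OF xs] by blast
next
  fix v assume "v \<in> Chi_iter E n r"
  then show "v \<in> generation V E r n"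
    using depth_Chi_iter_root Chi_iter_in_V r_in_V by (auto simp: generation_def)
qed

lemma generationI: "v \<in> V \<Longrightarrow> v \<in> generation V E r (depth E r v)"
  by (simp add: generation_def)

lemma depth_Chi_iter:
  assumes "v \<in> V" "u \<in> Chi_iter E n v"
  shows "depth E r u = depth E r v + n"
proof -
  have "v \<in> Chi_iter E (depth E r v) r"
    using generationI[OF assms(1)] by (simp add: generation_eq_Chi_iter)
  then have "u \<in> Chi_iter E (depth E r v + n) r"
    using assms(2) by (auto simp: Chi_iter_add)
  then show ?thesis by (rule depth_Chi_iter_root)
qed

lemma Chi_iter_subset_generation:
  "v \<in> V \<Longrightarrow> Chi_iter E n v \<subseteq> generation V E r (depth E r v + n)"
  using depth_Chi_iter Chi_iter_in_V by (auto simp: generation_def)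

text \<open>
  The unique path to a descendant runs through the generations one by one; bounding the depth of
  its vertices shows that appending a child of its end cannot repeat a vertex.
\<close>

lemma Chi_iter_path:
  assumes "v \<in> V"
  shows "u \<in> Chi_iter E n v \<Longrightarrow>
    \<exists>xs. is_path E v u xs \<and> (\<forall>y\<in>set xs. depth E r y \<le> depth E r v + n)"
proof (induction n arbitrary: u)
  case 0
  then show ?case using is_path_refl[of E v] by (intro exI[of _ "[v]"]) simp
next
  case (Suc n)
  then obtain x where x: "x \<in> Chi_iter E n v" "(x, u) \<in> E" by (auto simp: Chi_def)
  then obtain xs where xs: "is_path E v x xs" "\<forall>y\<in>set xs. depth E r y \<le> depth E r v + n"
    using Suc.IH by blast
  have du: "depth E r u = depth E r v + Suc n" using Suc.prems assms depth_Chi_iter by blast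
  then have "u \<notin> set xs" using xs(2) by fastforce
  then have "is_path E v u (xs @ [u])"
    using xs(1) x(2) by (auto simp: is_path_def successively_append_iff adjacent_def)
  then show ?case using xs(2) du by (intro exI[of _ "xs @ [u]"]) auto
qed

lemma path_weight_refl: "path_weight E w v v = 1"
  by (simp add: path_weight_def the_path_eq[OF is_path_refl])

lemma path_weight_child:
  assumes "v \<in> V" "x \<in> Chi_iter E n v" "u \<in> Chi E x"
  shows "path_weight E w v u = path_weight E w v x * w u"
proof -
  obtain xs where xs: "is_path E v x xs" "\<forall>y\<in>set xs. depth E r y \<le> depth E r v + n"
    using Chi_iter_path assms by blast
  have "u \<in> Chi_iter E (Suc n) v" using assms by auto
  then have "depth E r u = depth E r v + Suc n" using assms(1) depth_Chi_iter by blast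
  then have "u \<notin> set xs" using xs(2) by fastforce
  then have "is_path E v u (xs @ [u])"
    using xs(1) assms(3) by (auto simp: is_path_def successively_append_iff adjacent_def Chi_def)
  moreover have "xs \<noteq> []" using xs(1) by (simp add: is_path_def)
  ultimately show ?thesis using xs(1) by (simp add: path_weight_def the_path_eq)
qed

lemma path_weight_mult:
  assumes "v \<in> V" "x \<in> Chi_iter E m v"
  shows "u \<in> Chi_iter E n x \<Longrightarrow> path_weight E w v u = path_weight E w v x * path_weight E w x u"
proof (induction n arbitrary: u)
  case 0
  then show ?case by (simp add: path_weight_refl)
next
  case (Suc n)
  then obtain y where y: "y \<in> Chi_iter E n x" "u \<in> Chi E y" by auto
  have "x \<in> V" using assms Chi_iter_in_V by blast
  moreover have "y \<in> Chi_iter E (m + n) v" using assms(2) y(1) by (auto simp: Chi_iter_add)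
  ultimately show ?case
    using path_weight_child[OF assms(1) _ y(2)] path_weight_child[OF _ y] Suc.IH[OF y(1)] by simp
qed

end

locale locally_finite_rooted_tree = rooted_tree +
  assumes leafless: "leafless V E"
    and locally_finite: "locally_finite_tree V E"
begin

lemma finite_Chi: "finite (Chi E v)"
proof (cases "v \<in> V")
  case True
  then show ?thesis using locally_finite by (simp add: locally_finite_tree_def)
next
  case False
  then have "Chi E v = {}" using E_subset by (auto simp: Chi_def)
  then show ?thesis by simp
qed

lemma finite_Chi_iter: "finite (Chi_iter E n v)"
  by (induction n) (auto simp: finite_Chi)

lemma Chi_iter_nonempty: "v \<in> V \<Longrightarrow> Chi_iter E n v \<noteq> {}"
proof (induction n)
  case 0
  then show ?case by simp
next
  case (Suc n)
  then obtain u where "u \<in> Chi_iter E n v" by blast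
  then show ?case using Suc.prems leafless Chi_iter_in_V by (fastforce simp: leafless_def)
qed

lemma finite_generation: "finite (generation V E r n)"
  by (simp add: generation_eq_Chi_iter finite_Chi_iter)

lemma gen_card_pos: "gen_card V E r n > 0"
  using finite_generation Chi_iter_nonempty[OF r_in_V]
  by (simp add: gen_card_def card_gt_0_iff generation_eq_Chi_iter finite_Chi_iter)

text \<open>
  The families \<open>Chi E x\<close>, where \<open>x\<close> runs through \<open>Chi_iter E n v\<close>, are disjoint, so the iterates of
  the shift collect each descendant of \<open>v\<close> exactly once.
\<close>

lemma backward_shift_funpow:
  assumes "v \<in> V"
  shows "(backward_shift E w ^^ n) f v = (\<Sum>u\<in>Chi_iter E n v. path_weight E w v u * f u)"
proof (induction n arbitrary: f)
  case 0
  then show ?case by (simp add: path_weight_refl)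
next
  case (Suc n)
  have "(backward_shift E w ^^ Suc n) f v = (backward_shift E w ^^ n) (backward_shift E w f) v"
    by (simp add: funpow_swap1)
  also have "\<dots> = (\<Sum>x\<in>Chi_iter E n v. \<Sum>u\<in>Chi E x. path_weight E w v x * (w u * f u))"
    unfolding Suc.IH by (simp add: backward_shift_def sum_distrib_left)
  also have "\<dots> = (\<Sum>x\<in>Chi_iter E n v. \<Sum>u\<in>Chi E x. path_weight E w v u * f u)"
    using path_weight_child[OF assms] by (intro sum.cong refl) simp
  also have "\<dots> = (\<Sum>u\<in>Chi_iter E (Suc n) v. path_weight E w v u * f u)"
    unfolding Chi_iter.simps
    by (rule sum.UNION_disjoint[symmetric])
      (auto simp: finite_Chi finite_Chi_iter dest: Chi_disjoint)
  finally show ?case .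
qed

end

section \<open>Minkowski's inequality for series\<close>

text \<open>
  This is convexity of the power function at the points \<open>x / s\<close> and \<open>y / t\<close> with weights proportional
  to \<open>s\<close> and \<open>t\<close>. If one of the points is zero, it reduces to \<open>q powr p \<le> q\<close> for \<open>0 \<le> q \<le> 1\<close>.
\<close>

lemma powr_convex_combination:
  fixes x y s t p :: real
  assumes "1 \<le> p" "0 \<le> x" "0 \<le> y" "0 < s" "0 < t"
  shows "((x + y) / (s + t)) powr p \<le> s / (s + t) * (x / s) powr p + t / (s + t) * (y / t) powr p"
proof -
  have degenerate: "(y / (s + t)) powr p \<le> t / (s + t) * (y / t) powr p"
    if "0 \<le> y" "0 < s" "0 < t" for y s t :: real
  proof -
    have "(t / (s + t)) powr p \<le> (t / (s + t)) powr 1"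
      using that assms(1) by (intro powr_mono') auto
    moreover have "(y / (s + t)) powr p = (t / (s + t)) powr p * (y / t) powr p"
      using that by (subst powr_mult[symmetric]) auto
    ultimately show ?thesis using that by (metis mult_right_mono powr_ge_zero powr_one divide_nonneg_pos add_pos_pos less_imp_le)
  qed
  consider "x = 0" | "y = 0" | "0 < x" "0 < y" using assms by linarith
  then show ?thesis
  proof cases
    case 1
    then show ?thesis using degenerate[of y s t] assms by simp
  next
    case 2
    then show ?thesis using degenerate[of x t s] assms by (simp add: add.commute)
  next
    case 3
    let ?q = "t / (s + t)"
    have q: "1 - ?q = s / (s + t)" using assms by (simp add: field_simps)
    have "((1 - ?q) *\<^sub>R (x / s) + ?q *\<^sub>R (y / t)) powr p
        \<le> (1 - ?q) * (x / s) powr p + ?q * (y / t) powr p"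
      using 3 assms by (intro convex_onD[OF powr_convex]) auto
    moreover have "(1 - ?q) *\<^sub>R (x / s) + ?q *\<^sub>R (y / t) = (x + y) / (s + t)"
      unfolding q using assms by (simp add: add_divide_distrib)
    ultimately show ?thesis unfolding q by simp
  qed
qed

text \<open>
  For \<open>s\<close> and \<open>t\<close> above the \<open>p\<close>-norms of \<open>a\<close> and \<open>b\<close>, summing the convexity inequality bounds the
  \<open>p\<close>-norm of \<open>c\<close> by \<open>s + t\<close>. Working with such \<open>s\<close> and \<open>t\<close> rather than with the norms
  themselves avoids division by zero.
\<close>

lemma minkowski_series:
  fixes a b c :: "nat \<Rightarrow> real"
  assumes p: "1 \<le> p"
    and nonneg: "\<And>n. 0 \<le> a n" "\<And>n. 0 \<le> b n" "\<And>n. 0 \<le> c n"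
    and le: "\<And>n. c n \<le> a n + b n"
    and summ: "summable (\<lambda>n. a n powr p)" "summable (\<lambda>n. b n powr p)"
  shows "summable (\<lambda>n. c n powr p)"
    and "(\<Sum>n. c n powr p) powr (1 / p) \<le> (\<Sum>n. a n powr p) powr (1 / p) + (\<Sum>n. b n powr p) powr (1 / p)"
proof -
  let ?A = "(\<Sum>n. a n powr p) powr (1 / p)" and ?B = "(\<Sum>n. b n powr p) powr (1 / p)"
  have key: "summable (\<lambda>n. c n powr p) \<and> (\<Sum>n. c n powr p) powr (1 / p) \<le> s + t"
    if "?A < s" "?B < t" for s t
  proof -
    have st: "0 < s" "0 < t"
      using that powr_ge_zero[of "\<Sum>n. a n powr p" "1 / p"]
        powr_ge_zero[of "\<Sum>n. b n powr p" "1 / p"] by linarith+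
    have a: "(\<Sum>n. a n powr p) \<le> s powr p"
    proof -
      have "?A powr p \<le> s powr p" using that p by (intro powr_mono2) auto
      then show ?thesis using p suminf_nonneg[OF summ(1)] by (simp add: powr_powr)
    qed
    have b: "(\<Sum>n. b n powr p) \<le> t powr p"
    proof -
      have "?B powr p \<le> t powr p" using that p by (intro powr_mono2) auto
      then show ?thesis using p suminf_nonneg[OF summ(2)] by (simp add: powr_powr)
    qed
    define g where "g n = (s + t) powr p *
      (s / (s + t) * (a n powr p / s powr p) + t / (s + t) * (b n powr p / t powr p))" for n
    have cg: "c n powr p \<le> g n" for n
    proof -
      have "c n powr p \<le> (a n + b n) powr p" using p nonneg le by (intro powr_mono2) auto
      also have "\<dots> = (s + t) powr p * ((a n + b n) / (s + t)) powr p"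
        using st nonneg by (simp add: powr_divide)
      also have "\<dots> \<le> (s + t) powr p *
          (s / (s + t) * (a n / s) powr p + t / (s + t) * (b n / t) powr p)"
        using p nonneg st by (intro mult_left_mono powr_convex_combination) auto
      also have "\<dots> = g n" by (simp add: g_def powr_divide)
      finally show ?thesis .
    qed
    have g: "g sums ((s + t) powr p * (s / (s + t) * ((\<Sum>n. a n powr p) / s powr p)
        + t / (s + t) * ((\<Sum>n. b n powr p) / t powr p)))"
      unfolding g_def using summ
      by (intro sums_mult sums_add sums_divide summable_sums)
    have sc: "summable (\<lambda>n. c n powr p)"
      by (rule summable_comparison_test'[OF sums_summable[OF g], of 0]) (simp add: cg)
    have "(\<Sum>n. c n powr p) \<le> (\<Sum>n. g n)"
      using cg sc sums_summable[OF g] by (rule suminf_le)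
    also have "\<dots> = (s + t) powr p * (s / (s + t) * ((\<Sum>n. a n powr p) / s powr p)
        + t / (s + t) * ((\<Sum>n. b n powr p) / t powr p))"
      using g by (simp add: sums_iff)
    also have "\<dots> \<le> (s + t) powr p * (s / (s + t) * 1 + t / (s + t) * 1)"
      using a b st by (intro mult_left_mono add_mono) auto
    also have "\<dots> = (s + t) powr p" using st by (simp add: add_divide_distrib[symmetric])
    finally have "(\<Sum>n. c n powr p) powr (1 / p) \<le> ((s + t) powr p) powr (1 / p)"
      using p suminf_nonneg[OF sc] by (intro powr_mono2) auto
    also have "\<dots> = s + t" using p st by (simp add: powr_powr)
    finally show ?thesis using sc by simp
  qed
  show "summable (\<lambda>n. c n powr p)" using key[of "?A + 1" "?B + 1"] by simp
  show "(\<Sum>n. c n powr p) powr (1 / p) \<le> ?A + ?B"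
  proof (rule field_le_epsilon)
    fix e :: real assume "0 < e"
    then show "(\<Sum>n. c n powr p) powr (1 / p) \<le> ?A + ?B + e"
      using key[of "?A + e / 2" "?B + e / 2"] by simp
  qed
qed

section \<open>The Cesaro space of a tree\<close>

locale ces_tree = locally_finite_rooted_tree +
  fixes p :: real
  assumes p: "1 < p"
begin

abbreviation "CES \<equiv> Ces V E r p"
abbreviation "cnorm \<equiv> ces_norm V E r p"

definition ces_mean :: "('a \<Rightarrow> complex) \<Rightarrow> nat \<Rightarrow> real" where
  "ces_mean f n = 1 / (real n + 1) * (\<Sum>k=0..n. gen_mean V E r k f)"

lemma ces_term_eq: "ces_term V E r p f n = ces_mean f n powr p"
  by (simp add: ces_term_def ces_mean_def)

lemma ces_norm_eq: "cnorm f = (\<Sum>n. ces_mean f n powr p) powr (1 / p)"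
  by (simp add: ces_norm_def ces_term_eq)

lemma CES_iff: "f \<in> CES \<longleftrightarrow> (\<forall>v. v \<notin> V \<longrightarrow> f v = 0) \<and> summable (\<lambda>n. ces_mean f n powr p)"
  by (simp add: Ces_def ces_term_eq[abs_def])

lemma CES_outside: "f \<in> CES \<Longrightarrow> v \<notin> V \<Longrightarrow> f v = 0"
  by (simp add: CES_iff)

lemma cnorm_nonneg: "0 \<le> cnorm f"
  by (simp add: ces_norm_def)

lemma cnorm_powr: "f \<in> CES \<Longrightarrow> cnorm f powr p = (\<Sum>n. ces_mean f n powr p)"
  using p suminf_nonneg[of "\<lambda>n. ces_mean f n powr p"] by (simp add: CES_iff ces_norm_eq powr_powr)

lemma gen_mean_nonneg: "0 \<le> gen_mean V E r n f"
  by (simp add: gen_mean_def sum_nonneg)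

lemma ces_mean_nonneg: "0 \<le> ces_mean f n"
  by (simp add: ces_mean_def sum_nonneg gen_mean_nonneg)

lemma gen_mean_subadditive:
  assumes "\<And>v. cmod (h v) \<le> cmod (f v) + cmod (g v)"
  shows "gen_mean V E r n h \<le> gen_mean V E r n f + gen_mean V E r n g"
  unfolding gen_mean_def distrib_left[symmetric] sum.distrib[symmetric]
  by (intro mult_left_mono sum_mono assms) simp

lemma ces_mean_subadditive:
  assumes "\<And>v. cmod (h v) \<le> cmod (f v) + cmod (g v)"
  shows "ces_mean h n \<le> ces_mean f n + ces_mean g n"
  unfolding ces_mean_def distrib_left[symmetric] sum.distrib[symmetric]
  by (intro mult_left_mono sum_mono gen_mean_subadditive assms) simp

lemma CES_zero: "(\<lambda>v. 0) \<in> CES"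
  and cnorm_zero: "cnorm (\<lambda>v. 0) = 0"
  using p by (simp_all add: CES_iff ces_norm_eq ces_mean_def gen_mean_def)

text \<open>
  Minkowski's inequality for the Cesaro means. Domination in place of equality makes this cover
  sums, differences and truncations at once.
\<close>

lemma CES_dominated:
  assumes "f \<in> CES" "g \<in> CES" "\<And>v. cmod (h v) \<le> cmod (f v) + cmod (g v)"
  shows "h \<in> CES" and "cnorm h \<le> cnorm f + cnorm g"
proof -
  have "h v = 0" if "v \<notin> V" for v
    using assms(3)[of v] CES_outside[OF assms(1) that] CES_outside[OF assms(2) that] by simp
  then show "h \<in> CES"
    using minkowski_series(1)[of p "ces_mean f" "ces_mean g" "ces_mean h"] assms p
    by (simp add: CES_iff ces_mean_nonneg ces_mean_subadditive)
  show "cnorm h \<le> cnorm f + cnorm g"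
    using minkowski_series(2)[of p "ces_mean f" "ces_mean g" "ces_mean h"] assms p
    by (simp add: CES_iff ces_norm_eq ces_mean_nonneg ces_mean_subadditive)
qed

lemma CES_add: "f \<in> CES \<Longrightarrow> g \<in> CES \<Longrightarrow> (\<lambda>v. f v + g v) \<in> CES"
  and cnorm_add_le: "f \<in> CES \<Longrightarrow> g \<in> CES \<Longrightarrow> cnorm (\<lambda>v. f v + g v) \<le> cnorm f + cnorm g"
  using CES_dominated[of f g "\<lambda>v. f v + g v"] norm_triangle_ineq by blast+

lemma CES_diff: "f \<in> CES \<Longrightarrow> g \<in> CES \<Longrightarrow> (\<lambda>v. f v - g v) \<in> CES"
  using CES_dominated(1)[of f g "\<lambda>v. f v - g v"] norm_triangle_ineq4 by blast

lemma CES_sum: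
  assumes "\<And>i. i \<in> I \<Longrightarrow> f i \<in> CES"
  shows "(\<lambda>v. \<Sum>i\<in>I. f i v) \<in> CES \<and> cnorm (\<lambda>v. \<Sum>i\<in>I. f i v) \<le> (\<Sum>i\<in>I. cnorm (f i))"
  using assms
proof (induction I rule: infinite_finite_induct)
  case (insert i I)
  then have I: "(\<lambda>v. \<Sum>i\<in>I. f i v) \<in> CES" "cnorm (\<lambda>v. \<Sum>i\<in>I. f i v) \<le> (\<Sum>i\<in>I. cnorm (f i))"
    and i: "f i \<in> CES" by auto
  show ?case using insert.hyps CES_add[OF i I(1)] cnorm_add_le[OF i I(1)] I(2) by simp
qed (simp_all add: CES_zero cnorm_zero)

lemma gen_mean_eq_0: "(\<And>v. v \<in> generation V E r n \<Longrightarrow> f v = 0) \<Longrightarrow> gen_mean V E r n f = 0"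
  by (simp add: gen_mean_def)

text \<open>The reciprocal of the norm of a unit point mass in generation \<open>m\<close>; see \<open>point_mass_CES\<close>.\<close>

definition ces_scale :: "nat \<Rightarrow> real" where
  "ces_scale m = real (gen_card V E r m) * Phi p m"

lemma summable_Phi: "summable (\<lambda>s. 1 / (real (N + s) + 1) powr p)"
proof -
  have "summable (\<lambda>n. real n powr (- p))" using p by (simp add: summable_real_powr_iff)
  then have "summable (\<lambda>s. real (s + Suc N) powr (- p))" by (rule summable_ignore_initial_segment)
  then show ?thesis by (simp add: powr_minus_divide add_ac)
qed

lemma Phi_sum_pos: "0 < (\<Sum>s. 1 / (real (N + s) + 1) powr p)"
  by (intro suminf_pos summable_Phi) (simp add: add_nonneg_pos)

lemma Phi_pos: "0 < Phi p N"
  using Phi_sum_pos[of N] by (simp add: Phi_def)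

lemma Phi_powr: "Phi p N powr p = 1 / (\<Sum>s. 1 / (real (N + s) + 1) powr p)"
proof -
  have "- 1 / p * p = - 1" using p by simp
  then show ?thesis
    unfolding Phi_def powr_powr using Phi_sum_pos[of N] by (simp add: powr_minus_divide)
qed

lemma ces_scale_pos: "0 < ces_scale m"
  by (simp add: ces_scale_def gen_card_pos Phi_pos)

text \<open>
  The average over generation \<open>m\<close> enters the \<open>n\<close>-th Cesaro mean for all \<open>n \<ge> m\<close> with the factor
  \<open>1 / (n + 1)\<close>; the \<open>p\<close>-th powers of these factors sum up to \<open>Phi p m powr (- p)\<close>.
\<close>

lemma generation_sum_le:
  assumes "f \<in> CES"
  shows "(\<Sum>v\<in>generation V E r m. cmod (f v)) \<le> ces_scale m * cnorm f"
proof -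
  define a where "a = gen_mean V E r m f"
  have a: "0 \<le> a" by (simp add: a_def gen_mean_nonneg)
  have sf: "summable (\<lambda>n. ces_mean f n powr p)" using assms by (simp add: CES_iff)
  have le: "a powr p * (1 / (real (m + s) + 1) powr p) \<le> ces_mean f (s + m) powr p" for s
  proof -
    have "a \<le> (\<Sum>k=0..s+m. gen_mean V E r k f)"
      unfolding a_def by (intro member_le_sum gen_mean_nonneg) auto
    then have "a / (real (m + s) + 1) \<le> ces_mean f (s + m)"
      by (simp add: ces_mean_def divide_right_mono add_ac)
    then have "(a / (real (m + s) + 1)) powr p \<le> ces_mean f (s + m) powr p"
      using p a by (intro powr_mono2) auto
    then show ?thesis using a by (simp add: powr_divide)
  qed
  have "a powr p * (\<Sum>s. 1 / (real (m + s) + 1) powr p)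
      = (\<Sum>s. a powr p * (1 / (real (m + s) + 1) powr p))"
    by (rule suminf_mult[symmetric, OF summable_Phi])
  also have "\<dots> \<le> (\<Sum>s. ces_mean f (s + m) powr p)"
    using le summable_mult[OF summable_Phi] summable_ignore_initial_segment[OF sf]
    by (rule suminf_le)
  also have "\<dots> \<le> (\<Sum>n. ces_mean f n powr p)"
    unfolding suminf_split_initial_segment[OF sf, of m] by (simp add: sum_nonneg)
  also have "\<dots> = cnorm f powr p" by (simp add: cnorm_powr assms)
  finally have "a powr p \<le> cnorm f powr p * Phi p m powr p"
    using Phi_sum_pos[of m] by (simp add: Phi_powr field_simps)
  also have "\<dots> = (cnorm f * Phi p m) powr p"
    using Phi_pos[of m] cnorm_nonneg by (simp add: powr_mult)
  finally have le: "a powr p \<le> (cnorm f * Phi p m) powr p" .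
  have "a \<le> cnorm f * Phi p m"
  proof (rule ccontr)
    assume "\<not> a \<le> cnorm f * Phi p m"
    then have "(cnorm f * Phi p m) powr p < a powr p"
      using p cnorm_nonneg[of f] Phi_pos[of m] by (intro powr_less_mono2) auto
    then show False using le by simp
  qed
  then show ?thesis
    using gen_card_pos[of m] by (simp add: a_def gen_mean_def ces_scale_def field_simps)
qed

lemma cmod_le_cnorm:
  assumes "f \<in> CES" "v \<in> V"
  shows "cmod (f v) \<le> ces_scale (depth E r v) * cnorm f"
proof -
  have "cmod (f v) \<le> (\<Sum>v\<in>generation V E r (depth E r v). cmod (f v))"
    using generationI[OF assms(2)] finite_generation by (intro member_le_sum) auto
  then show ?thesis using generation_sum_le[OF assms(1)] by (rule order_trans)
qed

definition point_mass :: "'a \<Rightarrow> complex \<Rightarrow> 'a \<Rightarrow> complex" where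
  "point_mass v c = (\<lambda>x. if x = v then c else 0)"

text \<open>
  Only the means from the generation of \<open>v\<close> on are nonzero, so that the estimate in
  \<open>generation_sum_le\<close> is an equality for point masses.
\<close>

lemma point_mass_CES:
  assumes "v \<in> V"
  shows "point_mass v c \<in> CES" and "cnorm (point_mass v c) = cmod c / ces_scale (depth E r v)"
proof -
  define m where "m = depth E r v"
  define a where "a = cmod c / real (gen_card V E r m)"
  have a: "0 \<le> a" by (simp add: a_def)
  have gm: "gen_mean V E r k (point_mass v c) = (if k = m then a else 0)" for k
  proof -
    have "(\<Sum>x\<in>generation V E r k. cmod (point_mass v c x))
        = (\<Sum>x\<in>generation V E r k. if x = v then cmod c else 0)"
      by (intro sum.cong) (auto simp: point_mass_def)
    also have "\<dots> = (if k = m then cmod c else 0)"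
      using assms finite_generation by (simp add: sum.delta generation_def m_def)
    finally show ?thesis by (simp add: gen_mean_def a_def)
  qed
  have cm: "ces_mean (point_mass v c) n = (if n < m then 0 else a / (real n + 1))" for n
    by (auto simp: ces_mean_def gm sum.delta)
  have sm: "(\<lambda>s. ces_mean (point_mass v c) (s + m) powr p) sums
      (a powr p * (\<Sum>s. 1 / (real (m + s) + 1) powr p))"
  proof -
    have "ces_mean (point_mass v c) (s + m) powr p = a powr p * (1 / (real (m + s) + 1) powr p)" for s
      using a by (simp add: cm powr_divide add_ac)
    then show ?thesis using sums_mult[OF summable_sums[OF summable_Phi]] by simp
  qed
  then have sums: "(\<lambda>n. ces_mean (point_mass v c) n powr p) sums
      (a powr p * (\<Sum>s. 1 / (real (m + s) + 1) powr p))"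
    by (subst (asm) sums_iff_shift) (simp add: cm)
  then show "point_mass v c \<in> CES"
    using assms by (auto simp: CES_iff sums_iff point_mass_def)
  have "cnorm (point_mass v c) = (a powr p * (\<Sum>s. 1 / (real (m + s) + 1) powr p)) powr (1 / p)"
    using sums by (simp add: ces_norm_eq sums_iff)
  also have "\<dots> = ((a / Phi p m) powr p) powr (1 / p)"
    using a Phi_pos[of m] by (simp add: powr_divide Phi_powr)
  also have "\<dots> = a / Phi p m" using a p Phi_pos[of m] by (simp add: powr_powr)
  finally show "cnorm (point_mass v c) = cmod c / ces_scale (depth E r v)"
    by (simp add: a_def ces_scale_def m_def)
qed

lemma Metric_space_CES: "Metric_space CES (\<lambda>f g. cnorm (\<lambda>v. f v - g v))"
proof
  fix f g h :: "'a \<Rightarrow> complex"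
  show "0 \<le> cnorm (\<lambda>v. f v - g v)" by (rule cnorm_nonneg)
  show "cnorm (\<lambda>v. f v - g v) = cnorm (\<lambda>v. g v - f v)"
    by (simp add: ces_norm_eq ces_mean_def gen_mean_def norm_minus_commute)
  assume f: "f \<in> CES" and g: "g \<in> CES"
  show "cnorm (\<lambda>v. f v - g v) = 0 \<longleftrightarrow> f = g"
  proof
    assume 0: "cnorm (\<lambda>v. f v - g v) = 0"
    show "f = g"
    proof
      fix v
      show "f v = g v"
        using cmod_le_cnorm[OF CES_diff[OF f g], of v] CES_outside[OF f] CES_outside[OF g] 0
        by (cases "v \<in> V") auto
    qed
  qed (simp add: cnorm_zero)
  assume h: "h \<in> CES"
  have "cmod (f v - h v) \<le> cmod (f v - g v) + cmod (g v - h v)" for v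
    using norm_triangle_ineq[of "f v - g v" "g v - h v"] by simp
  then show "cnorm (\<lambda>v. f v - h v) \<le> cnorm (\<lambda>v. f v - g v) + cnorm (\<lambda>v. g v - h v)"
    by (rule CES_dominated(2)[OF CES_diff[OF f g] CES_diff[OF g h]])
qed

lemma topspace_CES: "topspace (ces_topology V E r p) = CES"
  unfolding ces_topology_def by (rule Metric_space.topspace_mtopology[OF Metric_space_CES])

lemma openin_CES_ball:
  assumes "f \<in> CES"
  shows "openin (ces_topology V E r p) {g \<in> CES. cnorm (\<lambda>v. f v - g v) < e}"
  using Metric_space.openin_mball[OF Metric_space_CES, of f e] assms
  by (simp add: ces_topology_def Metric_space.mball_def[OF Metric_space_CES])

lemma openin_CES_ball_subset:
  assumes "openin (ces_topology V E r p) U" "f \<in> U"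
  obtains e where "0 < e" "{g \<in> CES. cnorm (\<lambda>v. f v - g v) < e} \<subseteq> U"
proof -
  obtain e where "0 < e" "Metric_space.mball CES (\<lambda>f g. cnorm (\<lambda>v. f v - g v)) f e \<subseteq> U"
    using assms unfolding ces_topology_def Metric_space.openin_mtopology[OF Metric_space_CES] by blast
  moreover have "f \<in> CES" using openin_subset[OF assms(1)] assms(2) topspace_CES by auto
  ultimately show thesis
    using that by (simp add: Metric_space.mball_def[OF Metric_space_CES])
qed

text \<open>Truncating \<open>f\<close> after generation \<open>n\<close> leaves an error controlled by a tail of its norm series.\<close>

lemma finitely_supported_dense:
  assumes f: "f \<in> CES" and e: "0 < e"
  obtains g n where "g \<in> CES" "\<And>v. n < depth E r v \<Longrightarrow> g v = 0" "cnorm (\<lambda>v. f v - g v) < e"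
proof -
  have sf: "summable (\<lambda>n. ces_mean f n powr p)" using f by (simp add: CES_iff)
  obtain N where N: "\<And>n. n \<ge> N \<Longrightarrow> norm (\<Sum>i. ces_mean f (i + n) powr p) < e powr p"
    using suminf_exist_split[OF _ sf, of "e powr p"] e by auto
  define g where "g v = (if depth E r v \<le> N then f v else 0)" for v
  define h where "h v = f v - g v" for v
  have g: "g \<in> CES"
    by (rule CES_dominated(1)[OF f CES_zero]) (simp add: g_def)
  have h: "h \<in> CES"
    by (rule CES_dominated(1)[OF f CES_zero]) (simp add: g_def h_def)
  have sh: "summable (\<lambda>n. ces_mean h n powr p)" using h by (simp add: CES_iff)
  have h0: "ces_mean h n = 0" if "n \<le> N" for n
  proof -
    have "gen_mean V E r k h = 0" if "k \<le> n" for k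
      using that \<open>n \<le> N\<close> by (intro gen_mean_eq_0) (auto simp: h_def g_def generation_def)
    then show ?thesis by (simp add: ces_mean_def)
  qed
  have hf: "ces_mean h n powr p \<le> ces_mean f n powr p" for n
  proof -
    have "ces_mean h n \<le> ces_mean f n + ces_mean (\<lambda>v. 0) n"
      by (rule ces_mean_subadditive) (simp add: h_def g_def)
    then show ?thesis
      using p ces_mean_nonneg by (intro powr_mono2) (auto simp: ces_mean_def gen_mean_def)
  qed
  have "cnorm h powr p = (\<Sum>n. ces_mean h n powr p)" by (rule cnorm_powr[OF h])
  also have "\<dots> = (\<Sum>n. ces_mean h (n + N) powr p)"
    by (subst suminf_split_initial_segment[OF sh, of N]) (simp add: h0)
  also have "\<dots> \<le> (\<Sum>n. ces_mean f (n + N) powr p)"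
    using hf summable_ignore_initial_segment[OF sh] summable_ignore_initial_segment[OF sf]
    by (rule suminf_le)
  also have "\<dots> < e powr p" using N[of N] by simp
  finally have less: "cnorm h powr p < e powr p" .
  have "cnorm h < e"
  proof (rule ccontr)
    assume "\<not> cnorm h < e"
    then have "e powr p \<le> cnorm h powr p" using p e by (intro powr_mono2) auto
    then show False using less by simp
  qed
  then show thesis using that[OF g, of N] by (simp add: h_def[abs_def] g_def)
qed

end

section \<open>Gain of the weighted shift along descendants\<close>

locale bounded_shift = ces_tree +
  fixes w :: "'a \<Rightarrow> complex"
  assumes bounded: "ces_bounded_operator V E r p (backward_shift E w)"
begin

abbreviation "B \<equiv> backward_shift E w"

text \<open>
  A point mass of norm one at a descendant \<open>u\<close> of \<open>v\<close>, \<open>n\<close> generations below, is shifted \<open>n\<close> times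
  to a function of modulus \<open>ces_scale (depth E r u) * cmod (path_weight E w v u)\<close> at \<open>v\<close>. The gain is
  the largest such value.
\<close>

definition gain :: "'a \<Rightarrow> nat \<Rightarrow> real" where
  "gain v n = ces_scale (depth E r v + n) * Max ((\<lambda>u. cmod (path_weight E w v u)) ` Chi_iter E n v)"

lemma gain_ge:
  "u \<in> Chi_iter E n v \<Longrightarrow> ces_scale (depth E r v + n) * cmod (path_weight E w v u) \<le> gain v n"
  unfolding gain_def using ces_scale_pos finite_Chi_iter
  by (intro mult_left_mono Max_ge) (auto simp: less_imp_le)

lemma gain_attained:
  assumes "v \<in> V"
  obtains u where "u \<in> Chi_iter E n v"
    "gain v n = ces_scale (depth E r v + n) * cmod (path_weight E w v u)"
proof -
  have "Max ((\<lambda>u. cmod (path_weight E w v u)) ` Chi_iter E n v)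
      \<in> (\<lambda>u. cmod (path_weight E w v u)) ` Chi_iter E n v"
    using finite_Chi_iter Chi_iter_nonempty[OF assms] by (intro Max_in) auto
  then show thesis using that by (auto simp: gain_def)
qed

lemma gain_nonneg:
  assumes "v \<in> V" shows "0 \<le> gain v n"
  using gain_attained[OF assms, of n] ces_scale_pos
  by (metis less_imp_le mult_nonneg_nonneg norm_ge_zero)

lemma B_CES: "f \<in> CES \<Longrightarrow> B f \<in> CES"
  using bounded by (simp add: ces_bounded_operator_def)

lemma B_funpow_CES: "f \<in> CES \<Longrightarrow> (B ^^ n) f \<in> CES"
  by (induction n) (auto intro: B_CES)

lemma B_point_mass:
  assumes "u \<in> Chi E x"
  shows "B (point_mass u 1) = point_mass x (w u)"
proof
  fix v
  have "B (point_mass u 1) v = (\<Sum>y\<in>Chi E v. if y = u then w u else 0)"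
    unfolding backward_shift_def by (intro sum.cong) (auto simp: point_mass_def)
  also have "\<dots> = (if u \<in> Chi E v then w u else 0)"
    using finite_Chi by (simp add: sum.delta)
  also have "\<dots> = point_mass x (w u) v"
    using assms Chi_disjoint by (auto simp: point_mass_def)
  finally show "B (point_mass u 1) v = point_mass x (w u) v" .
qed

text \<open>
  Testing boundedness on the point mass at a child controls the weight of that child, hence the
  growth of the gain from one generation to the next.
\<close>

lemma gain_Suc_le:
  obtains C where "1 \<le> C" "\<And>v n. v \<in> V \<Longrightarrow> gain v (Suc n) \<le> C * gain v n"
proof -
  obtain C0 where C0: "\<And>f. f \<in> CES \<Longrightarrow> cnorm (B f) \<le> C0 * cnorm f"
    using bounded unfolding ces_bounded_operator_def by blast
  define C where "C = max 1 C0"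
  have C: "cnorm (B f) \<le> C * cnorm f" if "f \<in> CES" for f
    using C0[OF that] mult_right_mono[of C0 C, OF _ cnorm_nonneg[of f]] by (simp add: C_def)
  have "gain v (Suc n) \<le> C * gain v n" if v: "v \<in> V" for v n
  proof -
    let ?d = "depth E r v"
    obtain u where u: "u \<in> Chi_iter E (Suc n) v"
      "gain v (Suc n) = ces_scale (?d + Suc n) * cmod (path_weight E w v u)"
      using gain_attained[OF v] .
    then obtain x where x: "x \<in> Chi_iter E n v" "u \<in> Chi E x" by auto
    have V: "x \<in> V" "u \<in> V" using x Chi_iter_in_V v Chi_in_V by blast+
    have d: "depth E r x = ?d + n" "depth E r u = ?d + Suc n"
      using depth_Chi_iter[OF v] x(1) u(1) by blast+
    have "cmod (w u) / ces_scale (?d + n) \<le> C / ces_scale (?d + Suc n)"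
      using C[OF point_mass_CES(1)[OF V(2)], of 1] unfolding B_point_mass[OF x(2)]
      by (simp add: point_mass_CES(2) V d)
    then have "ces_scale (?d + Suc n) * cmod (w u) \<le> C * ces_scale (?d + n)"
      using ces_scale_pos[of "?d + n"] ces_scale_pos[of "?d + Suc n"] by (simp add: field_simps)
    then have "ces_scale (?d + Suc n) * cmod (w u) * cmod (path_weight E w v x)
        \<le> C * ces_scale (?d + n) * cmod (path_weight E w v x)"
      by (rule mult_right_mono) simp
    then have "gain v (Suc n) \<le> C * (ces_scale (?d + n) * cmod (path_weight E w v x))"
      by (simp add: u(2) path_weight_child[OF v x] norm_mult mult_ac)
    also have "\<dots> \<le> C * gain v n"
      using gain_ge[OF x(1)] by (intro mult_left_mono) (auto simp: C_def)
    finally show ?thesis .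
  qed
  then show thesis using that[of C] by (simp add: C_def)
qed

text \<open>The descendants of a descendant are descendants, and path weights multiply.\<close>

lemma gain_descendant:
  assumes "v \<in> V" "x \<in> Chi_iter E m v"
  shows "cmod (path_weight E w v x) * gain x n \<le> gain v (m + n)"
proof -
  have "x \<in> V" using assms Chi_iter_in_V by blast
  then obtain u where u: "u \<in> Chi_iter E n x"
    "gain x n = ces_scale (depth E r x + n) * cmod (path_weight E w x u)"
    using gain_attained by blast
  have "u \<in> Chi_iter E (m + n) v" using assms(2) u(1) by (auto simp: Chi_iter_add)
  from gain_ge[OF this] show ?thesis
    by (simp add: u(2) depth_Chi_iter[OF assms] path_weight_mult[OF assms u(1)] norm_mult mult_ac add_ac)
qed

section \<open>Transitivity forces large gains\<close>

text \<open>
  Taking the largest path weight out of the formula for \<open>(B ^^ n) f v\<close> leaves a sum over a part of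
  one generation, which \<open>generation_sum_le\<close> bounds by the norm of \<open>f\<close>.
\<close>

lemma cmod_B_funpow_le:
  assumes "f \<in> CES" "v \<in> V"
  shows "cmod ((B ^^ n) f v) \<le> gain v n * cnorm f"
proof -
  let ?M = "Max ((\<lambda>u. cmod (path_weight E w v u)) ` Chi_iter E n v)"
  have M: "cmod (path_weight E w v u) \<le> ?M" if "u \<in> Chi_iter E n v" for u
    using that finite_Chi_iter by (intro Max_ge) auto
  have "0 \<le> ?M"
    using M Chi_iter_nonempty[OF assms(2), of n] norm_ge_zero order_trans by (metis ex_in_conv)
  have "cmod ((B ^^ n) f v) \<le> (\<Sum>u\<in>Chi_iter E n v. cmod (path_weight E w v u * f u))"
    unfolding backward_shift_funpow[OF assms(2)] by (rule norm_sum)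
  also have "\<dots> \<le> (\<Sum>u\<in>Chi_iter E n v. ?M * cmod (f u))"
    using M by (intro sum_mono) (simp add: norm_mult mult_right_mono)
  also have "\<dots> \<le> ?M * (\<Sum>u\<in>generation V E r (depth E r v + n). cmod (f u))"
    unfolding sum_distrib_left[symmetric]
    using \<open>0 \<le> ?M\<close> Chi_iter_subset_generation[OF assms(2)] finite_generation
    by (intro mult_left_mono sum_mono2) auto
  also have "\<dots> \<le> ?M * (ces_scale (depth E r v + n) * cnorm f)"
    using \<open>0 \<le> ?M\<close> generation_sum_le[OF assms(1)] by (rule mult_left_mono[rotated])
  finally show ?thesis by (simp add: gain_def mult_ac)
qed

text \<open>
  A point of a small ball around zero can only be shifted near the indicator function of \<open>F\<close> if
  the gain compensates for its norm at every vertex of \<open>F\<close>.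
\<close>

lemma transitive_imp_large_gain:
  assumes trans: "family_transitive \<F> (ces_topology V E r p) B" and up: "furstenberg_family \<F>"
    and F: "F \<subseteq> V" "finite F" and N: "1 \<le> N"
  shows "(\<Inter>v\<in>F. {n. real N < gain v n}) \<in> \<F>"
proof -
  define g where "g = (\<lambda>x. \<Sum>v\<in>F. point_mass v 1 x)"
  have g: "g \<in> CES"
    unfolding g_def using CES_sum[of F "\<lambda>v. point_mass v 1"] point_mass_CES(1) F(1) by blast
  have g1: "g v = 1" if "v \<in> F" for v
    using that F(2) by (simp add: g_def point_mass_def sum.delta)
  (* Point evaluations are bounded, so e-close functions differ by at most 1/2 on F. *)
  have "\<exists>e>0. \<forall>v\<in>F. ces_scale (depth E r v) * e \<le> 1 / 2"
  proof -
    define s where "s = 1 + (\<Sum>v\<in>F. ces_scale (depth E r v))"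
    have "0 < s" unfolding s_def using ces_scale_pos by (intro add_pos_nonneg sum_nonneg) (auto intro: less_imp_le)
    moreover have "ces_scale (depth E r v) \<le> s" if "v \<in> F" for v
      unfolding s_def using member_le_sum[OF that _ F(2), of "\<lambda>v. ces_scale (depth E r v)"]
        ces_scale_pos by (simp add: less_imp_le add_increasing)
    ultimately show ?thesis by (intro exI[of _ "1 / (2 * s)"]) (auto simp: field_simps)
  qed
  then obtain e where e: "0 < e" "\<And>v. v \<in> F \<Longrightarrow> ces_scale (depth E r v) * e \<le> 1 / 2" by blast
  define U where "U = {f \<in> CES. cnorm (\<lambda>v. 0 - f v) < 1 / (2 * real N)}"
  define W where "W = {f \<in> CES. cnorm (\<lambda>v. g v - f v) < e}"
  have U: "openin (ces_topology V E r p) U" "U \<noteq> {}"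
    unfolding U_def using openin_CES_ball[OF CES_zero] N CES_zero cnorm_zero by auto
  have W: "openin (ces_topology V E r p) W" "W \<noteq> {}"
    unfolding W_def using openin_CES_ball[OF g] g e(1) cnorm_zero by auto
  have "{n. (B ^^ n) ` U \<inter> W \<noteq> {}} \<in> \<F>"
    using trans U W by (simp add: family_transitive_def)
  moreover have "{n. (B ^^ n) ` U \<inter> W \<noteq> {}} \<subseteq> (\<Inter>v\<in>F. {n. real N < gain v n})"
  proof (intro subsetI INT_I CollectI)
    fix n v
    assume "n \<in> {n. (B ^^ n) ` U \<inter> W \<noteq> {}}" and v: "v \<in> F"
    then obtain f where f: "f \<in> U" and Bf: "(B ^^ n) f \<in> W" by blast
    have vV: "v \<in> V" using v F(1) by blast
    have fC: "f \<in> CES" and fn: "cnorm f < 1 / (2 * real N)"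
      using f by (simp_all add: U_def ces_norm_eq ces_mean_def gen_mean_def)
    have "cmod (g v - (B ^^ n) f v)
        \<le> ces_scale (depth E r v) * cnorm (\<lambda>v. g v - (B ^^ n) f v)"
      using cmod_le_cnorm[OF CES_diff[OF g] vV] Bf by (simp add: W_def)
    also have "\<dots> < ces_scale (depth E r v) * e"
      using Bf ces_scale_pos by (simp add: W_def)
    also have "\<dots> \<le> 1 / 2" by (rule e(2)[OF v])
    finally have "1 / 2 < cmod ((B ^^ n) f v)"
      using norm_triangle_ineq2[of 1 "(B ^^ n) f v"] by (simp add: g1[OF v])
    also have "\<dots> \<le> gain v n * cnorm f" by (rule cmod_B_funpow_le[OF fC vV])
    also have "\<dots> \<le> gain v n * (1 / (2 * real N))"
      using fn gain_nonneg[OF vV] by (intro mult_left_mono) auto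
    finally show "real N < gain v n" using N by (simp add: field_simps)
  qed
  ultimately show ?thesis using up unfolding furstenberg_family_def by blast
qed

section \<open>Large gains give thick transitivity\<close>

text \<open>
  If the gain at a descendant of \<open>v\<close> in generation \<open>K\<close> below \<open>v\<close> exceeds a large bound at time \<open>n\<close>,
  then so does the gain at \<open>v\<close> at time \<open>n + K\<close>, and boundedness transports this down to all times
  between \<open>n - K\<close> and \<open>n + K\<close>. The bound is moreover taken above all gains at the times
  before \<open>n0\<close>, which excludes these times; they cannot simply be deleted, since a member of the
  family need not stay in it when finitely many points are removed.
\<close>

lemma large_gain_window:
  assumes large: "\<forall>F N. F \<subseteq> V \<and> F \<noteq> {} \<and> finite F \<and> 1 \<le> N \<longrightarrow>
      (\<Inter>v\<in>F. {n. real N < gain v n}) \<in> \<F>"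
    and fam: "furstenberg_family \<F>"
    and F: "F \<subseteq> V" "F \<noteq> {}" "finite F"
  obtains A where "A \<in> \<F>" "\<And>n. n \<in> A \<Longrightarrow> n0 \<le> n"
    "\<And>n m v. n \<in> A \<Longrightarrow> n \<le> m + K \<Longrightarrow> m \<le> n + K \<Longrightarrow> v \<in> F \<Longrightarrow> R < gain v m"
proof -
  have "\<exists>x\<in>Chi_iter E K v. path_weight E w v x \<noteq> 0" if "v \<in> F" for v
  proof -
    have v: "v \<in> V" using that F(1) by blast
    have "(\<Inter>v\<in>{v}. {n. real 1 < gain v n}) \<in> \<F>" using v by (intro large[rule_format]) auto
    then have "infinite {n. 1 < gain v n}" using fam by (simp add: furstenberg_family_def)
    (* Members of the family are infinite, so the gain is positive at some time n \<ge> K; the path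
       that attains it has nonzero weight, and so has its initial piece of length K. *)
    then obtain n where n: "K \<le> n" "1 < gain v n" by (auto simp: infinite_nat_iff_unbounded_le)
    obtain u where u: "u \<in> Chi_iter E n v"
      "gain v n = ces_scale (depth E r v + n) * cmod (path_weight E w v u)"
      using gain_attained[OF v] .
    then have u0: "path_weight E w v u \<noteq> 0" using n(2) by auto
    have "u \<in> Chi_iter E (K + (n - K)) v" using u(1) n(1) by simp
    then obtain x where x: "x \<in> Chi_iter E K v" "u \<in> Chi_iter E (n - K) x"
      unfolding Chi_iter_add by blast
    then show ?thesis using path_weight_mult[OF v x] u0 by auto
  qed
  then obtain x where x: "\<And>v. v \<in> F \<Longrightarrow> x v \<in> Chi_iter E K v"
      "\<And>v. v \<in> F \<Longrightarrow> path_weight E w v (x v) \<noteq> 0"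
    by metis
  obtain C where C: "1 \<le> C" "\<And>v n. v \<in> V \<Longrightarrow> gain v (Suc n) \<le> C * gain v n"
    using gain_Suc_le by blast
  have Cpow: "gain v (m + k) \<le> C ^ k * gain v m" if "v \<in> V" for v m k
  proof (induction k)
    case (Suc k)
    have "gain v (m + Suc k) \<le> C * gain v (m + k)" using C(2)[OF that] by simp
    also have "\<dots> \<le> C * (C ^ k * gain v m)" using Suc C(1) by (intro mult_left_mono) auto
    finally show ?case by (simp add: mult_ac)
  qed simp
  define bound where "bound v = \<bar>R\<bar> * C ^ (2 * K) / cmod (path_weight E w v (x v))" for v
  (* Passing from x v at time n to v at a time in the window costs at most the factor C ^ (2 * K)
     besides the path weight. N dominates the resulting bounds and the gains at the times before n0; the 1 ensures N \<ge> 1. *)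
  define Rs where "Rs = bound ` F \<union> (\<lambda>(v, n). gain (x v) n) ` (F \<times> {..<n0}) \<union> {1}"
  have "finite Rs" using F(3) by (simp add: Rs_def)
  define N where "N = nat \<lceil>Max Rs\<rceil>"
  have N: "t \<le> real N" if "t \<in> Rs" for t
    using Max_ge[OF \<open>finite Rs\<close> that] real_nat_ceiling_ge[of "Max Rs"] unfolding N_def by linarith
  have "1 \<le> N" using N[of 1] by (simp add: Rs_def)
  define A where "A = (\<Inter>y\<in>x ` F. {n. real N < gain y n})"
  have xV: "x v \<in> V" if "v \<in> F" for v using x(1)[OF that] that F(1) Chi_iter_in_V by blast
  have "A \<in> \<F>" unfolding A_def using \<open>1 \<le> N\<close> F xV by (intro large[rule_format]) auto
  moreover have "n0 \<le> n" if "n \<in> A" for n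
  proof (rule ccontr)
    assume "\<not> n0 \<le> n"
    obtain v where v: "v \<in> F" using F(2) by blast
    then have "gain (x v) n \<in> Rs" unfolding Rs_def using \<open>\<not> n0 \<le> n\<close> by force
    then show False using N that v unfolding A_def by fastforce
  qed
  moreover have "R < gain v m" if "n \<in> A" "n \<le> m + K" "m \<le> n + K" "v \<in> F" for n m v
  proof -
    have v: "v \<in> V" using that F(1) by blast
    let ?c = "cmod (path_weight E w v (x v))"
    have c: "0 < ?c" using x(2)[OF that(4)] by simp
    define k where "k = n + K - m"
    have k: "K + n = m + k" "k \<le> 2 * K" using that by (auto simp: k_def)
    have "bound v \<le> real N" using N that(4) by (simp add: Rs_def)
    also have "\<dots> < gain (x v) n" using that(1,4) by (simp add: A_def)
    finally have "\<bar>R\<bar> * C ^ (2 * K) < ?c * gain (x v) n"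
      using c by (simp add: bound_def field_simps)
    also have "\<dots> \<le> gain v (m + k)"
      using gain_descendant[OF v x(1)[OF that(4)], of n] by (simp add: k(1))
    also have "\<dots> \<le> C ^ k * gain v m" by (rule Cpow[OF v])
    also have "\<dots> \<le> C ^ (2 * K) * gain v m"
      using C(1) k(2) gain_nonneg[OF v] by (intro mult_right_mono power_increasing) auto
    finally have "C ^ (2 * K) * \<bar>R\<bar> < C ^ (2 * K) * gain v m" by (simp add: mult_ac)
    then have "\<bar>R\<bar> < gain v m" using C(1) by (simp add: mult_less_cancel_left_pos)
    then show ?thesis by linarith
  qed
  ultimately show thesis using that by blast
qed

text \<open>
  A preimage of \<open>g\<close> of small norm: the value at \<open>v\<close> is put, divided by the path weight, on a
  descendant of \<open>v\<close> that attains the gain. Different vertices have different descendants in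
  generation \<open>m\<close> below them, so these choices do not interfere.
\<close>

lemma small_preimage:
  assumes F: "F \<subseteq> V" "finite F" and g: "g \<in> CES" "\<And>v. v \<notin> F \<Longrightarrow> g v = 0"
    and R: "0 < R" "\<And>v. v \<in> F \<Longrightarrow> R < gain v m"
  obtains h where "h \<in> CES" "cnorm h \<le> (\<Sum>v\<in>F. cmod (g v)) / R"
    "\<And>v. v \<in> V \<Longrightarrow> (B ^^ m) h v = g v"
proof -
  have "\<exists>u. u \<in> Chi_iter E m v \<and> gain v m = ces_scale (depth E r v + m) * cmod (path_weight E w v u)"
    if "v \<in> F" for v
    using gain_attained[of v m] that F(1) by blast
  then obtain u where u: "\<And>v. v \<in> F \<Longrightarrow> u v \<in> Chi_iter E m v"
      "\<And>v. v \<in> F \<Longrightarrow> gain v m = ces_scale (depth E r v + m) * cmod (path_weight E w v (u v))"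
    by metis
  have w0: "path_weight E w v (u v) \<noteq> 0" if "v \<in> F" for v
    using R(1) R(2)[OF that] u(2)[OF that] by auto
  define h where "h = (\<lambda>y. \<Sum>v\<in>F. point_mass (u v) (g v / path_weight E w v (u v)) y)"
  have uV: "u v \<in> V" if "v \<in> F" for v using u(1)[OF that] that F(1) Chi_iter_in_V by blast
  have h: "h \<in> CES"
    and hn: "cnorm h \<le> (\<Sum>v\<in>F. cnorm (point_mass (u v) (g v / path_weight E w v (u v))))"
    unfolding h_def using CES_sum[of F "\<lambda>v. point_mass (u v) (g v / path_weight E w v (u v))"]
      point_mass_CES(1) uV by blast+
  note hn
  also have "(\<Sum>v\<in>F. cnorm (point_mass (u v) (g v / path_weight E w v (u v))))
      \<le> (\<Sum>v\<in>F. cmod (g v) / R)"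
  proof (rule sum_mono)
    fix v assume v: "v \<in> F"
    have "cnorm (point_mass (u v) (g v / path_weight E w v (u v))) = cmod (g v) / gain v m"
      using depth_Chi_iter[OF _ u(1)[OF v]] v F(1)
      by (simp add: point_mass_CES(2) uV norm_divide u(2) subset_iff mult_ac)
    also have "\<dots> \<le> cmod (g v) / R"
      using R(1) R(2)[OF v] by (intro divide_left_mono mult_pos_pos) auto
    finally show "cnorm (point_mass (u v) (g v / path_weight E w v (u v))) \<le> cmod (g v) / R" .
  qed
  finally have "cnorm h \<le> (\<Sum>v\<in>F. cmod (g v)) / R" by (simp add: sum_divide_distrib)
  moreover have "(B ^^ m) h v = g v" if v: "v \<in> V" for v
  proof -
    have "(B ^^ m) h v = (\<Sum>y\<in>Chi_iter E m v. \<Sum>x\<in>F.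
        path_weight E w v y * point_mass (u x) (g x / path_weight E w x (u x)) y)"
      unfolding backward_shift_funpow[OF v] by (simp add: h_def sum_distrib_left)
    also have "\<dots> = (\<Sum>x\<in>F. \<Sum>y\<in>Chi_iter E m v.
        path_weight E w v y * point_mass (u x) (g x / path_weight E w x (u x)) y)"
      by (rule sum.swap)
    also have "\<dots> = (\<Sum>x\<in>F. if x = v then g x else 0)"
    proof (rule sum.cong[OF refl])
      fix x assume x: "x \<in> F"
      have "(\<Sum>y\<in>Chi_iter E m v. path_weight E w v y * point_mass (u x) (g x / path_weight E w x (u x)) y)
        = (\<Sum>y\<in>Chi_iter E m v. if y = u x then path_weight E w v y * (g x / path_weight E w x (u x)) else 0)"
        by (intro sum.cong) (auto simp: point_mass_def)
      also have "\<dots> = (if u x \<in> Chi_iter E m v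
          then path_weight E w v (u x) * (g x / path_weight E w x (u x)) else 0)"
        using finite_Chi_iter by (simp add: sum.delta)
      also have "\<dots> = (if x = v then g x else 0)"
      proof (cases "x = v")
        case True
        then show ?thesis using u(1)[OF x] w0[OF x] by simp
      next
        case False
        then show ?thesis using Chi_iter_disjoint[OF u(1)[OF x]] by auto
      qed
      finally show "(\<Sum>y\<in>Chi_iter E m v. path_weight E w v y * point_mass (u x) (g x / path_weight E w x (u x)) y)
        = (if x = v then g x else 0)" .
    qed
    also have "\<dots> = g v" using F(2) g(2) by (simp add: sum.delta)
    finally show ?thesis .
  qed
  ultimately show thesis using that h by blast
qed

text \<open>
  After replacing the two open sets by balls around finitely supported \<open>f\<close> and \<open>g\<close>, the shift
  annihilates \<open>f\<close> at all late times, so adding a small preimage of \<open>g\<close> to \<open>f\<close> hits \<open>g\<close> exactly.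
\<close>

lemma large_gain_imp_tilde_transitive:
  assumes large: "\<forall>F N. F \<subseteq> V \<and> F \<noteq> {} \<and> finite F \<and> 1 \<le> N \<longrightarrow>
      (\<Inter>v\<in>F. {n. real N < gain v n}) \<in> \<F>"
    and fam: "furstenberg_family \<F>"
  shows "family_transitive (tilde_family \<F>) (ces_topology V E r p) B"
  unfolding family_transitive_def
proof (intro allI impI, elim conjE)
  fix U W :: "('a \<Rightarrow> complex) set"
  assume U: "openin (ces_topology V E r p) U" "U \<noteq> {}"
    and W: "openin (ces_topology V E r p) W" "W \<noteq> {}"
  obtain f1 where f1: "f1 \<in> U" using U(2) by blast
  obtain g1 where g1: "g1 \<in> W" using W(2) by blast
  have C1: "f1 \<in> CES" "g1 \<in> CES"
    using f1 g1 openin_subset[OF U(1)] openin_subset[OF W(1)] topspace_CES by auto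
  obtain e where e: "0 < e" "{f \<in> CES. cnorm (\<lambda>v. f1 v - f v) < e} \<subseteq> U"
    using openin_CES_ball_subset[OF U(1) f1] .
  obtain d where d: "0 < d" "{f \<in> CES. cnorm (\<lambda>v. g1 v - f v) < d} \<subseteq> W"
    using openin_CES_ball_subset[OF W(1) g1] .
  obtain f nf where f: "f \<in> CES" "\<And>v. nf < depth E r v \<Longrightarrow> f v = 0"
      "cnorm (\<lambda>v. f1 v - f v) < e / 2"
    using finitely_supported_dense[OF C1(1), of "e / 2"] e(1) by (metis half_gt_zero)
  obtain g ng where g: "g \<in> CES" "\<And>v. ng < depth E r v \<Longrightarrow> g v = 0"
      "cnorm (\<lambda>v. g1 v - g v) < d"
    using finitely_supported_dense[OF C1(2) d(1)] by metis
  have gW: "g \<in> W" using d(2) g by blast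
  define F where "F = (\<Union>k\<le>ng. generation V E r k)"
  have F: "F \<subseteq> V" "finite F"
    unfolding F_def by (auto simp: generation_def intro: finite_generation[unfolded generation_def])
  have gF: "g v = 0" if "v \<notin> F" for v
    using that g(2) CES_outside[OF g(1)] by (force simp: F_def generation_def not_less[symmetric])
  have "r \<in> F"
    using depth_Chi_iter_root[of r 0] r_in_V by (simp add: F_def generation_def)
  then have Fne: "F \<noteq> {}" by blast
  define S where "S = (\<Sum>v\<in>F. cmod (g v))"
  define R where "R = 2 * S / e + 1"
  have "0 \<le> S" unfolding S_def by (rule sum_nonneg) simp
  then have R: "0 < R" using e(1) by (simp add: R_def add_nonneg_pos)
  have "S < e / 2 * R" using e(1) by (simp add: R_def field_simps)
  then have SR: "S / R < e / 2" using R by (simp add: pos_divide_less_eq)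
  have hit: "(B ^^ m) ` U \<inter> W \<noteq> {}" if m: "nf < m" "\<And>v. v \<in> F \<Longrightarrow> R < gain v m" for m
  proof -
    obtain h where h: "h \<in> CES" "cnorm h \<le> S / R"
        "\<And>v. v \<in> V \<Longrightarrow> (B ^^ m) h v = g v"
      using small_preimage[OF F g(1) gF R m(2)] unfolding S_def by metis
    let ?f = "\<lambda>v. f v + h v"
    have fC: "?f \<in> CES" by (rule CES_add[OF f(1) h(1)])
    have "cnorm (\<lambda>v. f1 v - ?f v) \<le> cnorm (\<lambda>v. f1 v - f v) + cnorm h"
      using norm_triangle_ineq4[of "f1 v - f v" "h v" for v]
      by (intro CES_dominated(2)[OF CES_diff[OF C1(1) f(1)] h(1)]) (simp add: algebra_simps)
    also have "\<dots> < e" using f(3) h(2) SR by linarith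
    finally have "?f \<in> U" using e(2) fC by blast
    moreover have "(B ^^ m) ?f = g"
    proof
      fix v
      show "(B ^^ m) ?f v = g v"
      proof (cases "v \<in> V")
        case True
        have "f u = 0" if "u \<in> Chi_iter E m v" for u
          using f(2)[of u] depth_Chi_iter[OF True that] m(1) by simp
        then have "(B ^^ m) ?f v = (B ^^ m) h v"
          unfolding backward_shift_funpow[OF True] by (intro sum.cong) auto
        then show ?thesis using h(3)[OF True] by simp
      next
        case False
        then show ?thesis using CES_outside[OF B_funpow_CES[OF fC]] CES_outside[OF g(1)] by simp
      qed
    qed
    ultimately show ?thesis using gW by blast
  qed
  show "{n. (B ^^ n) ` U \<inter> W \<noteq> {}} \<in> tilde_family \<F>"
    unfolding tilde_family_def
  proof (intro CollectI allI)
    fix K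
    obtain A where A: "A \<in> \<F>" "\<And>n. n \<in> A \<Longrightarrow> Suc (nf + K) \<le> n"
      "\<And>n m v. n \<in> A \<Longrightarrow> n \<le> m + K \<Longrightarrow> m \<le> n + K \<Longrightarrow> v \<in> F \<Longrightarrow> R < gain v m"
      using large_gain_window[OF large fam F(1) Fne F(2), where K = K and R = R and ?n0.0 = "Suc (nf + K)"]
      by metis
    have "thickening A K \<subseteq> {n. (B ^^ n) ` U \<inter> W \<noteq> {}}"
    proof
      fix m assume "m \<in> thickening A K"
      then obtain n where n: "n \<in> A" "n \<le> m + K" "m \<le> n + K"
        by (auto simp: thickening_def)
      then have "nf < m" using A(2)[OF n(1)] by linarith
      then show "m \<in> {n. (B ^^ n) ` U \<inter> W \<noteq> {}}" using hit A(3)[OF n] by blast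
    qed
    then show "\<exists>A\<in>\<F>. thickening A K \<subseteq> {n. (B ^^ n) ` U \<inter> W \<noteq> {}}" using A(1) by blast
  qed
qed

end

lemma tilde_family_subset:
  assumes "furstenberg_family \<F>"
  shows "tilde_family \<F> \<subseteq> \<F>"
proof
  fix A assume "A \<in> tilde_family \<F>"
  then obtain B where B: "B \<in> \<F>" "thickening B 0 \<subseteq> A" unfolding tilde_family_def by blast
  have "B \<subseteq> thickening B 0" by (auto simp: thickening_def)
  then show "A \<in> \<F>" using B assms unfolding furstenberg_family_def by blast
qed

theorem theorem3p5:
  fixes V :: "'a set" and E :: "('a \<times> 'a) set" and r :: 'a
    and p :: real and w :: "'a \<Rightarrow> complex" and \<F> :: "nat set set"
  assumes "1 < p"
    and "rooted_directed_tree V E r"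
    and "leafless V E"
    and "locally_finite_tree V E"
    and "ces_bounded_operator V E r p (backward_shift E w)"
    and "furstenberg_family \<F>"
  defines "assertion_i \<equiv>
      family_transitive (tilde_family \<F>) (ces_topology V E r p) (backward_shift E w)"
    and "assertion_ii \<equiv> family_transitive \<F> (ces_topology V E r p) (backward_shift E w)"
    and "assertion_iii \<equiv>
      (\<forall>F N. F \<subseteq> V \<and> F \<noteq> {} \<and> finite F \<and> 1 \<le> N \<longrightarrow>
        (\<Inter>v\<in>F. {n. real (gen_card V E r (depth E r v + n)) * Phi p (depth E r v + n)
                    * Max ((\<lambda>u. cmod (path_weight E w v u)) ` Chi_iter E n v) > real N}) \<in> \<F>)"
  shows "(assertion_i \<longleftrightarrow> assertion_ii) \<and> (assertion_ii \<longleftrightarrow> assertion_iii)"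
proof -
  interpret bounded_shift V E r p w
    by unfold_locales (fact assms)+
  have iii: "assertion_iii \<longleftrightarrow> (\<forall>F N. F \<subseteq> V \<and> F \<noteq> {} \<and> finite F \<and> 1 \<le> N \<longrightarrow>
      (\<Inter>v\<in>F. {n. real N < gain v n}) \<in> \<F>)"
    by (simp add: assertion_iii_def gain_def ces_scale_def)
  have "assertion_i \<Longrightarrow> assertion_ii"
    using tilde_family_subset[OF assms(6)]
    unfolding assertion_i_def assertion_ii_def family_transitive_def by blast
  moreover have "assertion_ii \<Longrightarrow> assertion_iii"
    unfolding iii assertion_ii_def using transitive_imp_large_gain assms(6) by blast
  moreover have "assertion_iii \<Longrightarrow> assertion_i"
    unfolding iii assertion_i_def using assms(6) by (intro large_gain_imp_tilde_transitive)
  ultimately show ?thesis by blast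
qed

end
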